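(* Let $(V,\|\cdot\|)$ be a normed plane and let $[\cdot,\cdot]$ be a fixed non-degenerate symplectic bilinear form on $V$. Then $(V,\|\cdot\|)$ is Radon if and only if there exists a number $\lambda>0$ such that $|[x,y]|=\lambda$ whenever $x,y\in V$ are unit vectors with $x\dashv_B y$.
   Context: A normed plane is a two-dimensional real vector space $V$ with a norm $\|\cdot\|$. A vector $x$ is Birkhoff orthogonal to $y$, written $x\dashv_B y$, if $\|x\|\le\|x+ty\|$ for every $t\in\mathbb{R}$. The normed plane is called Radon if its unit circle $\{x\in V:\|x\|=1\}$ is a Radon curve. The origin is denoted $o$. A convex body is a compact convex set with interior points. Radon curves. A curve $\gamma\subset V$ is a Radon curve if it arises from the following construction. Take linearly independent $v,w\in V$ and let $[\cdot,\cdot]_{v,w}$ be the non-degenerate symplectic bilinear form on $V$ with $[v,w]_{v,w}=1$ (a rescaling of the fixed form $[\cdot,\cdot]$). Let $\gamma_1$ be a curve connecting $v$ and $w$, with $\gamma_1\subseteq\mathrm{conv}\{o,v,w,v+w\}$, such that the union of $\gamma_1$ with the segments from $o$ to $v$ and from $o$ to $w$ is the boundary of a convex body. Let $\gamma_2$ be the curve $$\gamma_2(\lambda)=\frac{(1-\lambda)w+\lambda(-v)}{\sup_{x\in\gamma_1}|[x,(1-\lambda)w+\lambda(-v)]_{v,w}|},\qquad \lambda\in[0,1].$$ Then $\gamma=\gamma_1\cup\gamma_2\cup(-\gamma_1)\cup(-\gamma_2)$. *)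

theory Defs
  imports "HOL-Analysis.Analysis"
begin

definition birkhoff_orthogonal :: "'a::real_normed_vector \<Rightarrow> 'a \<Rightarrow> bool" where
  "birkhoff_orthogonal x y \<longleftrightarrow> (\<forall>t::real. norm x \<le> norm (x + t *\<^sub>R y))"

definition symplectic_form :: "('a::real_vector \<Rightarrow> 'a \<Rightarrow> real) \<Rightarrow> bool" where
  "symplectic_form \<omega> \<longleftrightarrow>
     bilinear \<omega> \<and> (\<forall>x. \<omega> x x = 0) \<and> (\<forall>x. (\<forall>y. \<omega> x y = 0) \<longrightarrow> x = 0)"

definition convex_body :: "'a::real_normed_vector set \<Rightarrow> bool" where
  "convex_body K \<longleftrightarrow> compact K \<and> convex K \<and> interior K \<noteq> {}"

definition dual_curve ::
    "('a::real_vector \<Rightarrow> 'a \<Rightarrow> real) \<Rightarrow> 'a \<Rightarrow> 'a \<Rightarrow> 'a set \<Rightarrow> real \<Rightarrow> 'a" where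
  "dual_curve \<omega> v w C l =
     (let y = (1 - l) *\<^sub>R w + l *\<^sub>R (- v) in y /\<^sub>R (SUP x\<in>C. \<bar>\<omega> x y\<bar>))"

(* Meant for two-dimensional spaces. There \<omega> is unique, since a symplectic form is
   determined by its value on one basis; hence the notion does not depend on any
   form fixed beforehand.
   Curves connecting v and w are taken to be simple (arcs), so that \<gamma>1 cannot retrace
   parts of the segments [0,v] and [0,w]: it meets them in v and w only. *)
definition radon_curve :: "'a::real_normed_vector set \<Rightarrow> bool" where
  "radon_curve \<gamma> \<longleftrightarrow>
     (\<exists>v w \<omega> g K \<gamma>1 \<gamma>2.
        v \<noteq> w \<and> independent {v, w} \<and>
        symplectic_form \<omega> \<and> \<omega> v w = 1 \<and>
        arc g \<and> pathstart g = v \<and> pathfinish g = w \<and> \<gamma>1 = path_image g \<and>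
        \<gamma>1 \<subseteq> convex hull {0, v, w, v + w} \<and>
        convex_body K \<and> \<gamma>1 \<union> closed_segment 0 v \<union> closed_segment 0 w = frontier K \<and>
        \<gamma>2 = dual_curve \<omega> v w \<gamma>1 ` {0..1} \<and>
        \<gamma> = \<gamma>1 \<union> \<gamma>2 \<union> uminus ` \<gamma>1 \<union> uminus ` \<gamma>2)"

definition radon_plane :: "'a::real_normed_vector itself \<Rightarrow> bool" where
  "radon_plane _ \<longleftrightarrow> radon_curve {x::'a. norm x = 1}"

end

(* A unit vector x is Birkhoff orthogonal to y iff it maximises |[., y]| on the unit ball, so the
   condition says that h y := sup {|[x, y]| : |x| = 1} is a constant multiple of the norm.
   In coordinates with respect to v, w a Radon circle lies in the square [-1, 1]^2, which lets the
   supremum in the construction run over the whole circle; hence h y = |y| in the second quadrant,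
   and duality (a support line) transfers this to the first one.
   Conversely, if |[x, y]| is constant, any unit v, w with v orthogonal to w have coordinates
   bounded by 1 on the unit ball, and the circle is rebuilt from its arc between v and w. *)
theory Submission
  imports Defs
begin

text \<open>Once \<open>\<omega> v w = 1\<close>, the coordinates of \<open>x\<close> with respect
  to \<open>v\<close>, \<open>w\<close> are \<open>\<omega> x w\<close> and
  \<open>\<omega> v x\<close>. The construction of a Radon curve controls only the functionals
  \<open>\<omega> _ y\<close> with \<open>y\<close> in the second quadrant and tests them only on
  the first. The bound h y \<le> |y| extends to all pairs of quadrants by signs and antisymmetry;
  the obstacle is the reverse bound for \<open>y\<close> in the first quadrant. There a support
  functional at \<open>y\<close> has itself the form \<open>\<omega> _ u\<close>, and by
  antisymmetry \<open>u\<close> also serves as a test vector for \<open>y\<close>. If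
  \<open>u\<close> points into the second quadrant, its norm turns out to be at most 1; if it points
  into the first, nothing is known about its norm and the square has to give the bound. In the
  converse direction the hypothesis speaks of orthogonal pairs only. It determines h because
  compactness of the unit ball provides, for every nonzero \<open>y\<close>, a unit vector
  orthogonal to it. The type \<open>'a\<close> carries just a norm, so compactness and separation
  are carried over from \<open>real \<times> real\<close> by the coordinates.\<close>

text \<open>
  The identity \<open>cramer\<close> is what remains of two-dimensionality: three vectors are always
  linearly dependent, with the coefficients given by Cramer's rule.
\<close>
locale symplectic_plane =
  fixes \<omega> :: "'a::real_normed_vector \<Rightarrow> 'a \<Rightarrow> real"
  assumes symplectic: "symplectic_form \<omega>"
    and cramer: "\<omega> x y *\<^sub>R z = \<omega> z y *\<^sub>R x + \<omega> x z *\<^sub>R y"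

section \<open>Symplectic forms on a two-dimensional space\<close>

lemma symplectic_form_antisym:
  assumes "symplectic_form \<omega>"
  shows "\<omega> y x = - \<omega> x y"
proof -
  have b: "bilinear \<omega>" and a: "\<And>x. \<omega> x x = 0"
    using assms by (auto simp: symplectic_form_def)
  have "0 = \<omega> (x + y) (x + y)"
    using a by simp
  also have "\<dots> = \<omega> x y + \<omega> y x"
    unfolding bilinear_ladd[OF b] bilinear_radd[OF b] by (simp add: a)
  finally show ?thesis by simp
qed

lemma symplectic_plane_if_dim_2:
  fixes \<omega> :: "'a::real_normed_vector \<Rightarrow> 'a \<Rightarrow> real"
  assumes dim: "dim (UNIV :: 'a set) = 2" and sympl: "symplectic_form \<omega>"
  shows "symplectic_plane \<omega>"
proof
  show "symplectic_form \<omega>" by fact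
next
  fix x y z :: 'a
  have b: "bilinear \<omega>" and a: "\<And>x. \<omega> x x = 0"
    using sympl by (auto simp: symplectic_form_def)
  obtain B :: "'a set" where B: "UNIV \<subseteq> span B" "card B = 2"
    using dim basis_exists[of "UNIV :: 'a set"] by metis
  then obtain e f where "B = {e, f}"
    by (metis card_2_iff)
  have expand: "\<exists>s t. x = s *\<^sub>R e + t *\<^sub>R f" for x
  proof -
    have "x \<in> span {e, f}" using B \<open>B = {e, f}\<close> by auto
    then obtain s where "x - s *\<^sub>R e \<in> span {f}" by (auto simp: span_breakdown_eq)
    then obtain t where "x - s *\<^sub>R e = t *\<^sub>R f" by (auto simp: span_singleton)
    then have "x = s *\<^sub>R e + t *\<^sub>R f" by (simp add: algebra_simps)
    then show ?thesis by blast
  qed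
  obtain x1 x2 y1 y2 z1 z2 where "x = x1 *\<^sub>R e + x2 *\<^sub>R f" "y = y1 *\<^sub>R e + y2 *\<^sub>R f"
    "z = z1 *\<^sub>R e + z2 *\<^sub>R f"
    using expand by metis
  then show "\<omega> x y *\<^sub>R z = \<omega> z y *\<^sub>R x + \<omega> x z *\<^sub>R y"
    by (simp add: bilinear_ladd[OF b] bilinear_radd[OF b] bilinear_lmul[OF b] bilinear_rmul[OF b]
        a symplectic_form_antisym[OF sympl, of f e] algebra_simps)
qed

context symplectic_plane
begin

lemma bilin: "bilinear \<omega>"
  using symplectic by (simp add: symplectic_form_def)

lemma alt [simp]: "\<omega> x x = 0"
  using symplectic by (simp add: symplectic_form_def)

lemmas form_simps = bilinear_ladd[OF bilin] bilinear_radd[OF bilin] bilinear_lmul[OF bilin]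
  bilinear_rmul[OF bilin] bilinear_lneg[OF bilin] bilinear_rneg[OF bilin]
  bilinear_lsub[OF bilin] bilinear_rsub[OF bilin] bilinear_lzero[OF bilin] bilinear_rzero[OF bilin]

lemmas antisym = symplectic_form_antisym[OF symplectic]

lemma nondegenerate:
  assumes "y \<noteq> 0"
  obtains x where "\<omega> x y \<noteq> 0"
proof -
  obtain x where "\<omega> y x \<noteq> 0"
    using assms symplectic by (auto simp: symplectic_form_def)
  then show ?thesis using that[of x] antisym[of x y] by linarith
qed

lemma coordinates: "x = \<omega> x w *\<^sub>R v + \<omega> v x *\<^sub>R w" if "\<omega> v w = 1"
  using cramer[of v w x] that by simp

text \<open>The form is the determinant of the coordinates; the sign arguments on quadrants all
  start from this expansion.\<close>

lemma form_coordinates: "\<omega> x y = \<omega> x w * \<omega> v y - \<omega> v x * \<omega> y w" if "\<omega> v w = 1"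
proof -
  have "\<omega> x y = \<omega> (\<omega> x w *\<^sub>R v + \<omega> v x *\<^sub>R w) y"
    using coordinates[OF that] by metis
  then show ?thesis by (simp add: form_simps antisym[of w y])
qed

section \<open>Birkhoff orthogonality as maximality of the form\<close>

text \<open>If \<open>z\<close> is not parallel to \<open>y\<close>, the line spanned by
  \<open>z\<close> meets the line through \<open>x\<close> in direction \<open>y\<close>.
  Orthogonality says that the meeting point has norm at least 1, and Cramer's rule computes
  it.\<close>

lemma birkhoff_orthogonal_imp_maximal:
  assumes "norm x = 1" "birkhoff_orthogonal x y"
  shows "\<bar>\<omega> z y\<bar> \<le> \<bar>\<omega> x y\<bar> * norm z"
proof (cases "\<omega> z y = 0")
  case False
  have "x + t *\<^sub>R y \<noteq> 0" for t
    using assms by (metis birkhoff_orthogonal_def norm_zero not_one_le_zero)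
  have "norm (\<omega> z y *\<^sub>R (x + (\<omega> x z / \<omega> z y) *\<^sub>R y)) = \<bar>\<omega> z y\<bar> * norm (x + (\<omega> x z / \<omega> z y) *\<^sub>R y)"
    by simp
  moreover have "\<omega> z y *\<^sub>R (x + (\<omega> x z / \<omega> z y) *\<^sub>R y) = \<omega> x y *\<^sub>R z"
    using False by (simp add: cramer[of x y z] scaleR_right_distrib)
  moreover have "1 \<le> norm (x + (\<omega> x z / \<omega> z y) *\<^sub>R y)"
    using assms by (metis birkhoff_orthogonal_def)
  ultimately have "\<bar>\<omega> z y\<bar> * 1 \<le> norm (\<omega> x y *\<^sub>R z)"
    by (metis abs_ge_zero mult_left_mono)
  then show ?thesis by simp
qed simp

text \<open>The functional \<open>\<omega> _ y\<close> is constant along the line through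
  \<open>x\<close> in direction \<open>y\<close>, so maximality bounds the norm from below on that
  line. Nondegeneracy makes the factor \<open>\<bar>\<omega> x y\<bar>\<close> positive, so that it
  cancels.\<close>

lemma maximal_imp_birkhoff_orthogonal:
  assumes "norm x = 1" "y \<noteq> 0" "\<And>z. \<bar>\<omega> z y\<bar> \<le> \<bar>\<omega> x y\<bar> * norm z"
  shows "birkhoff_orthogonal x y"
  unfolding birkhoff_orthogonal_def
proof
  fix t :: real
  obtain z where "\<omega> z y \<noteq> 0" using nondegenerate assms(2) by blast
  then have "0 < \<bar>\<omega> x y\<bar>" using assms(3)[of z] by auto
  moreover have "\<bar>\<omega> x y\<bar> \<le> \<bar>\<omega> x y\<bar> * norm (x + t *\<^sub>R y)"
    using assms(3)[of "x + t *\<^sub>R y"] by (simp add: form_simps)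
  ultimately show "norm x \<le> norm (x + t *\<^sub>R y)"
    using assms(1) by simp
qed

section \<open>Support lines, equivalence of norms, compactness\<close>

text \<open>This is Hahn-Banach in the plane, with the functional represented by the form:
  \<open>u\<close> is the direction of a support line of the unit ball at \<open>y\<close>.\<close>

lemma support_functional:
  assumes "\<omega> v w = 1" "norm y = 1"
  obtains u where "\<omega> y u = 1" "\<And>z. \<bar>\<omega> z u\<bar> \<le> norm z"
proof -
  let ?\<Phi> = "\<lambda>p::real \<times> real. fst p *\<^sub>R v + snd p *\<^sub>R w"
  let ?S = "{p. norm (?\<Phi> p) < 1}"
  have "linear ?\<Phi>"
    by (rule linearI) (auto simp: algebra_simps)
  moreover have "?S = ?\<Phi> -` ball 0 1" by auto
  ultimately have convex: "convex ?S"
    by (metis convex_ball convex_linear_vimage)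
  have "(0, 0) \<in> ?S" by simp
  then have nonempty: "?S \<noteq> {}" by blast
  have disjoint: "?S \<inter> {(\<omega> y w, \<omega> v y)} = {}"
    using coordinates[OF assms(1), of y, symmetric] assms(2) by auto
  obtain n c where n: "n \<noteq> 0" "\<And>p. p \<in> ?S \<Longrightarrow> inner n p \<le> c"
      "c \<le> inner n (\<omega> y w, \<omega> v y)"
    using separating_hyperplane_sets[OF convex convex_singleton nonempty insert_not_empty disjoint]
    by blast
  \<comment> \<open>In coordinates \<open>u0\<close> is the normal \<open>n\<close> turned by a
    quarter, which rewrites the inner product with \<open>n\<close> as the form.\<close>
  define u0 where "u0 = fst n *\<^sub>R w - snd n *\<^sub>R v"
  have pair: "inner n (\<omega> z w, \<omega> v z) = \<omega> z u0" for z
    by (cases n) (simp add: u0_def form_simps antisym[of z v])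
  have ball: "\<omega> z u0 \<le> c" if "norm z < 1" for z
    using n(2)[of "(\<omega> z w, \<omega> v z)"] coordinates[OF assms(1), of z, symmetric] that pair[of z] by auto
  have le: "\<omega> z u0 \<le> c * norm z" for z
  proof (cases "z = 0")
    case False
    \<comment> \<open>The separation concerns the open ball, so \<open>z\<close> is first scaled to
      norm \<open>s < 1\<close>; letting \<open>s\<close> tend to 1 gives the claim.\<close>
    have "s * \<omega> z u0 \<le> c * norm z" if "0 < s" "s < 1" for s
    proof -
      have "\<omega> ((s / norm z) *\<^sub>R z) u0 \<le> c"
        using False that by (intro ball) simp
      then show ?thesis using False by (simp add: form_simps field_simps)
    qed
    then show ?thesis
      by (rule field_le_mult_one_interval)
  qed (simp add: form_simps)
  have absle: "\<bar>\<omega> z u0\<bar> \<le> c * norm z" for z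
    using le[of z] le[of "-z"] by (simp add: form_simps)
  have "\<omega> y u0 = c"
    using n(3) pair[of y] le[of y] assms(2) by simp
  have "c > 0"
  proof (rule ccontr)
    assume "\<not> 0 < c"
    then have "c * norm z \<le> 0" for z by (simp add: mult_nonpos_nonneg)
    then have "\<omega> z u0 = 0" for z
      using absle[of z] by (meson abs_le_zero_iff order_trans)
    from this[of w] this[of v] have "fst n = 0" "snd n = 0"
      using assms(1) by (auto simp: u0_def form_simps antisym[of w v])
    then show False using n(1) by (simp add: prod_eq_iff)
  qed
  show ?thesis
  proof (rule that[of "u0 /\<^sub>R c"])
    show "\<omega> y (u0 /\<^sub>R c) = 1"
      using \<open>\<omega> y u0 = c\<close> \<open>c > 0\<close> by (simp add: form_simps)
    show "\<bar>\<omega> z (u0 /\<^sub>R c)\<bar> \<le> norm z" for z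
      using absle[of z] \<open>c > 0\<close> by (simp add: form_simps abs_mult field_simps)
  qed
qed

text \<open>Compactness of the Euclidean unit circle makes the norm attain a positive minimum
  \<open>m\<close> on it. This half of the equivalence of norms carries both the boundedness of the
  form and the compactness of the unit ball.\<close>

lemma obtain_finite_dim_bound:
  assumes "\<omega> v w = 1"
  obtains m where "m > 0" "\<And>p. m * norm p \<le> norm (fst p *\<^sub>R v + snd p *\<^sub>R w)"
proof -
  let ?\<Phi> = "\<lambda>p::real \<times> real. fst p *\<^sub>R v + snd p *\<^sub>R w"
  have "continuous_on (sphere 0 1) (\<lambda>p. norm (?\<Phi> p))"
    by (intro continuous_intros)
  moreover have "sphere (0::real \<times> real) 1 \<noteq> {}" by simp
  ultimately obtain p0 where p0: "p0 \<in> sphere 0 1" "\<And>p. p \<in> sphere 0 1 \<Longrightarrow> norm (?\<Phi> p0) \<le> norm (?\<Phi> p)"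
    using continuous_attains_inf[OF compact_sphere[of 0 1]] by blast
  have "?\<Phi> p0 \<noteq> 0"
  proof
    assume *: "?\<Phi> p0 = 0"
    have "\<omega> (?\<Phi> p0) w = fst p0" "\<omega> v (?\<Phi> p0) = snd p0"
      using assms by (simp_all add: form_simps)
    with * have "fst p0 = 0" "snd p0 = 0" by (auto simp: form_simps)
    then have "p0 = 0" by (simp add: prod_eq_iff)
    then show False using p0(1) by simp
  qed
  moreover have "norm (?\<Phi> p0) * norm p \<le> norm (?\<Phi> p)" for p
  proof (cases "p = 0")
    case False
    have "norm (?\<Phi> p0) \<le> norm (?\<Phi> (p /\<^sub>R norm p))"
      using False by (intro p0(2)) simp
    also have "?\<Phi> (p /\<^sub>R norm p) = ?\<Phi> p /\<^sub>R norm p"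
      by (simp add: scaleR_right_distrib)
    finally have "norm (?\<Phi> p0) \<le> norm (?\<Phi> p) / norm p"
      by (simp only: norm_scaleR) (simp add: divide_inverse mult.commute)
    then show ?thesis using False by (simp add: pos_le_divide_eq)
  qed simp
  ultimately show ?thesis
    by (intro that[of "norm (?\<Phi> p0)"]) simp_all
qed

lemma bounded_bilinear_form:
  assumes "\<omega> v w = 1"
  shows "bounded_bilinear \<omega>"
proof -
  obtain m where m: "m > 0" "\<And>p. m * norm p \<le> norm (fst p *\<^sub>R v + snd p *\<^sub>R w)"
    using obtain_finite_dim_bound[OF assms] by blast
  have bound: "\<bar>\<omega> x w\<bar> \<le> norm x / m" "\<bar>\<omega> v x\<bar> \<le> norm x / m" for x
  proof -
    have "norm (\<omega> x w, \<omega> v x) \<le> norm x / m"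
      using m(2)[of "(\<omega> x w, \<omega> v x)"] coordinates[OF assms, of x] \<open>m > 0\<close>
      by (simp add: field_simps)
    then show "\<bar>\<omega> x w\<bar> \<le> norm x / m" "\<bar>\<omega> v x\<bar> \<le> norm x / m"
      using norm_fst_le[of "\<omega> x w" "\<omega> v x"] norm_snd_le[of "\<omega> v x" "\<omega> x w"] by auto
  qed
  show ?thesis
  proof
    show "\<exists>K. \<forall>x y. norm (\<omega> x y) \<le> norm x * norm y * K"
    proof (intro exI allI)
      fix x y
      have "\<bar>\<omega> x y\<bar> \<le> \<bar>\<omega> x w\<bar> * \<bar>\<omega> v y\<bar> + \<bar>\<omega> v x\<bar> * \<bar>\<omega> y w\<bar>"
        unfolding form_coordinates[OF assms, of x y] by (metis abs_mult abs_triangle_ineq4)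
      also have "\<dots> \<le> norm x / m * (norm y / m) + norm x / m * (norm y / m)"
        using bound \<open>m > 0\<close> by (intro add_mono mult_mono) auto
      finally show "norm (\<omega> x y) \<le> norm x * norm y * (2 / m\<^sup>2)"
        by (simp add: power2_eq_square field_simps)
    qed
  qed (auto simp: form_simps)
qed

lemma compact_unit_cball:
  assumes "\<omega> v w = 1"
  shows "compact (cball (0::'a) 1)"
proof -
  let ?\<Phi> = "\<lambda>p::real \<times> real. fst p *\<^sub>R v + snd p *\<^sub>R w"
  obtain m where m: "m > 0" "\<And>p. m * norm p \<le> norm (?\<Phi> p)"
    using obtain_finite_dim_bound[OF assms] by blast
  let ?P = "{p. norm (?\<Phi> p) \<le> 1}"
  have "norm p \<le> 1 / m" if "p \<in> ?P" for p
    using m(2)[of p] that \<open>m > 0\<close> by (simp add: field_simps)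
  then have "bounded ?P" unfolding bounded_iff by blast
  moreover have "closed ?P"
    by (intro closed_Collect_le continuous_intros)
  ultimately have "compact ?P" by (simp add: compact_eq_bounded_closed)
  moreover have "continuous_on ?P ?\<Phi>" by (intro continuous_intros)
  ultimately have "compact (?\<Phi> ` ?P)" by (rule compact_continuous_image[rotated])
  moreover have "?\<Phi> ` ?P = cball 0 1"
  proof (intro equalityI subsetI)
    fix x :: 'a assume "x \<in> cball 0 1"
    then show "x \<in> ?\<Phi> ` ?P"
      using coordinates[OF assms, of x] by (intro image_eqI[of _ _ "(\<omega> x w, \<omega> v x)"]) auto
  qed auto
  ultimately show ?thesis by simp
qed

text \<open>By compactness the functional \<open>\<omega> _ y\<close> has a maximiser on the unit
  ball, and the maximiser has norm 1 because the functional is not zero.\<close>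

lemma birkhoff_orthogonal_exists:
  fixes y :: 'a
  assumes "\<omega> v w = 1" "y \<noteq> 0"
  obtains x where "norm x = 1" "birkhoff_orthogonal x y"
proof -
  interpret bounded_bilinear \<omega> by (rule bounded_bilinear_form) fact
  have "continuous_on (cball 0 1) (\<lambda>z. \<bar>\<omega> z y\<bar>)"
    by (intro continuous_on_rabs continuous_on continuous_on_id continuous_on_const)
  then obtain x where x: "norm x \<le> 1" "\<And>z. norm z \<le> 1 \<Longrightarrow> \<bar>\<omega> z y\<bar> \<le> \<bar>\<omega> x y\<bar>"
    using continuous_attains_sup[OF compact_unit_cball[OF assms(1)]]
    by (metis cball_eq_empty mem_cball_0 not_one_less_zero)
  have max: "\<bar>\<omega> z y\<bar> \<le> \<bar>\<omega> x y\<bar> * norm z" for z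
  proof (cases "z = 0")
    case False
    have "\<bar>\<omega> (z /\<^sub>R norm z) y\<bar> \<le> \<bar>\<omega> x y\<bar>" using False by (intro x(2)) simp
    then show ?thesis using False by (simp add: form_simps abs_mult field_simps)
  qed (simp add: form_simps)
  obtain z where "\<omega> z y \<noteq> 0" using nondegenerate assms(2) by blast
  then have "0 < \<bar>\<omega> x y\<bar>" using max[of z] by auto
  then have "norm x = 1"
    using max[of x] x(1) by simp
  then show ?thesis
    using that maximal_imp_birkhoff_orthogonal[of x y] max assms(2) by blast
qed

end

text \<open>Dividing by the coordinate sum \<open>a + b\<close> moves \<open>x\<close> radially onto
  the chord from \<open>p\<close> to \<open>q\<close>. This inverts the parametrisation of arcs as
  normalised chords, for the first curve as well as for the dual one.\<close>

lemma normalized_convex_combination: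
  assumes "norm x = 1" "x = a *\<^sub>R p + b *\<^sub>R q" "0 \<le> a" "0 \<le> b"
  obtains t where "t \<in> {0..1}"
    "x = ((1 - t) *\<^sub>R p + t *\<^sub>R q) /\<^sub>R norm ((1 - t) *\<^sub>R p + t *\<^sub>R q)"
    "(1 - t) *\<^sub>R p + t *\<^sub>R q = x /\<^sub>R (a + b)" "0 < a + b"
proof -
  have "0 < a + b"
  proof (rule ccontr)
    assume "\<not> 0 < a + b"
    then have "a = 0" "b = 0" using assms by linarith+
    then show False using assms by simp
  qed
  define t where "t = b / (a + b)"
  have t: "t \<in> {0..1}" "1 - t = a / (a + b)"
    using \<open>0 < a + b\<close> assms by (auto simp: t_def field_simps)
  have eq: "(1 - t) *\<^sub>R p + t *\<^sub>R q = x /\<^sub>R (a + b)"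
    unfolding t(2) by (simp add: t_def assms(2) scaleR_right_distrib divide_inverse mult.commute)
  have normalized: "(x /\<^sub>R (a + b)) /\<^sub>R norm (x /\<^sub>R (a + b)) = x"
    using \<open>0 < a + b\<close> assms(1) by simp
  show ?thesis
    by (rule that[OF t(1) _ eq \<open>0 < a + b\<close>]) (simp only: eq normalized)
qed

section \<open>From a Radon circle to a constant value of the form\<close>

context symplectic_plane
begin

text \<open>The hypotheses \<open>upper\<close> and \<open>least\<close> encode the construction of
  the second arc: for \<open>y\<close> on it, the supremum of
  \<open>\<bar>\<omega> x y\<bar>\<close> over the first arc is 1. They are phrased by bounds, so
  that no attainment has to be discussed.\<close>

lemma form_eq_1_if_quadrants_polar:
  assumes vw: "\<omega> v w = 1" and unit: "norm v = 1" "norm w = 1"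
    and box: "\<And>x. norm x = 1 \<Longrightarrow> 0 \<le> \<omega> x w \<Longrightarrow> 0 \<le> \<omega> v x \<Longrightarrow> \<omega> x w \<le> 1 \<and> \<omega> v x \<le> 1"
    and upper: "\<And>x y. norm x = 1 \<Longrightarrow> 0 \<le> \<omega> x w \<Longrightarrow> 0 \<le> \<omega> v x \<Longrightarrow>
      norm y = 1 \<Longrightarrow> \<omega> y w \<le> 0 \<Longrightarrow> 0 \<le> \<omega> v y \<Longrightarrow> \<bar>\<omega> x y\<bar> \<le> 1"
    and least: "\<And>y c. norm y = 1 \<Longrightarrow> \<omega> y w \<le> 0 \<Longrightarrow> 0 \<le> \<omega> v y \<Longrightarrow>
      (\<And>x. norm x = 1 \<Longrightarrow> 0 \<le> \<omega> x w \<Longrightarrow> 0 \<le> \<omega> v x \<Longrightarrow> \<bar>\<omega> x y\<bar> \<le> c) \<Longrightarrow> 1 \<le> c"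
    and xy: "norm x = 1" "norm y = 1" "birkhoff_orthogonal x y"
  shows "\<bar>\<omega> x y\<bar> = 1"
proof -
  define Q1 where "Q1 z \<longleftrightarrow> 0 \<le> \<omega> z w \<and> 0 \<le> \<omega> v z" for z
  define Q2 where "Q2 z \<longleftrightarrow> \<omega> z w \<le> 0 \<and> 0 \<le> \<omega> v z" for z
  have quadrants: "Q1 z \<or> Q2 z \<or> Q1 (- z) \<or> Q2 (- z)" for z
    unfolding Q1_def Q2_def by (auto simp: form_simps)
  have v: "Q1 v" and w: "Q1 w"
    using vw by (auto simp: Q1_def)
  \<comment> \<open>Since \<open>v\<close> and \<open>w\<close> lie on the first arc,
    \<open>upper\<close> applied to them bounds the coordinates on the second arc.\<close>
  have square0: "\<bar>\<omega> z w\<bar> \<le> 1 \<and> \<bar>\<omega> v z\<bar> \<le> 1" if "norm z = 1" "Q1 z \<or> Q2 z" for z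
    using that box[of z] upper[of v z] upper[of w z] v w unit antisym[of z w]
    unfolding Q1_def Q2_def by auto
  have le0: "\<bar>\<omega> z u\<bar> \<le> 1" if zu: "norm z = 1" "norm u = 1" "Q1 z \<or> Q2 z" "Q1 u \<or> Q2 u" for z u
  proof -
    have prods: "\<bar>\<omega> z w * \<omega> v u\<bar> \<le> 1" "\<bar>\<omega> v z * \<omega> u w\<bar> \<le> 1"
      using square0[of z] square0[of u] zu by (simp_all add: abs_mult mult_le_one)
    \<comment> \<open>Within one quadrant the two products of the determinant have equal signs and
      modulus at most 1, hence so has their difference modulus at most 1. Mixed quadrants fall under
      \<open>upper\<close>.\<close>
    consider "Q1 z" "Q1 u" | "Q1 z" "Q2 u" | "Q2 z" "Q1 u" | "Q2 z" "Q2 u"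
      using zu by blast
    then show ?thesis
    proof cases
      case 1
      then have "0 \<le> \<omega> z w * \<omega> v u" "0 \<le> \<omega> v z * \<omega> u w"
        by (simp_all add: Q1_def)
      then show ?thesis using prods form_coordinates[OF vw, of z u] by linarith
    next
      case 2
      then show ?thesis using upper zu by (simp add: Q1_def Q2_def)
    next
      case 3
      then show ?thesis using upper[of u z] zu antisym[of z u] by (simp add: Q1_def Q2_def)
    next
      case 4
      then have "\<omega> z w * \<omega> v u \<le> 0" "\<omega> v z * \<omega> u w \<le> 0"
        by (simp_all add: Q2_def mult_nonneg_nonpos mult_nonpos_nonneg)
      then show ?thesis using prods form_coordinates[OF vw, of z u] by linarith
    qed
  qed
  have le: "\<bar>\<omega> z u\<bar> \<le> 1" if "norm z = 1" "norm u = 1" for z u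
  proof -
    obtain z' u' where "Q1 z' \<or> Q2 z'" "Q1 u' \<or> Q2 u'" "z' = z \<or> z' = - z" "u' = u \<or> u' = - u"
      using quadrants by metis
    then show ?thesis
      using le0[of z' u'] that by (auto simp: form_simps)
  qed
  \<comment> \<open>By orthogonality \<open>M\<close> is the norm of the functional
    \<open>\<omega> _ y\<close>; it remains to show that it is at least 1.\<close>
  define M where "M = \<bar>\<omega> x y\<bar>"
  have max: "\<bar>\<omega> z y\<bar> \<le> M * norm z" for z
    unfolding M_def by (rule birkhoff_orthogonal_imp_maximal) fact+
  obtain y' where y': "Q1 y' \<or> Q2 y'" "y' = y \<or> y' = - y"
    using quadrants by metis
  then have max': "\<bar>\<omega> z y'\<bar> \<le> M * norm z" and "norm y' = 1" for z
    using max[of z] xy by (auto simp: form_simps)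
  from y'(1) have "1 \<le> M"
  proof
    assume "Q2 y'"
    show ?thesis
    proof (rule least)
      show "\<bar>\<omega> z y'\<bar> \<le> M" if "norm z = 1" for z
        using max'[of z] that by simp
    qed (use \<open>Q2 y'\<close> \<open>norm y' = 1\<close> in \<open>auto simp: Q2_def\<close>)
  next
    assume "Q1 y'"
    obtain u where u: "\<omega> y' u = 1" "\<And>z. \<bar>\<omega> z u\<bar> \<le> norm z"
      using support_functional[OF vw \<open>norm y' = 1\<close>] by blast
    then have "u \<noteq> 0" by (auto simp: form_simps)
    have u_coords: "\<bar>\<omega> v u\<bar> \<le> 1" "\<bar>\<omega> u w\<bar> \<le> 1"
      using u(2)[of v] u(2)[of w] unit antisym[of u w] by auto
    have y'_coords: "0 \<le> \<omega> y' w" "0 \<le> \<omega> v y'" "\<omega> y' w \<le> M" "\<omega> v y' \<le> M"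
      using \<open>Q1 y'\<close> max'[of v] max'[of w] unit antisym[of y' w] by (auto simp: Q1_def)
    have one: "\<omega> y' w * \<omega> v u - \<omega> v y' * \<omega> u w = 1"
      using form_coordinates[OF vw, of y' u] u(1) by simp
    \<comment> \<open>Here \<open>least\<close> at the normalised \<open>u'\<close> yields
      \<open>norm u \<le> 1\<close>; evaluating the functional of \<open>y'\<close> at
      \<open>u\<close> then gives \<open>1 \<le> M * norm u \<le> M\<close>.\<close>
    have polar: "1 \<le> M" if "Q2 u'" "u' = u \<or> u' = - u" for u'
    proof -
      have "norm u' = norm u" using that by auto
      have "1 \<le> 1 / norm u"
      proof (rule least[of "u' /\<^sub>R norm u"])
        show "norm (u' /\<^sub>R norm u) = 1"
          using \<open>norm u' = norm u\<close> \<open>u \<noteq> 0\<close> by simp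
        show "\<omega> (u' /\<^sub>R norm u) w \<le> 0" "0 \<le> \<omega> v (u' /\<^sub>R norm u)"
          using \<open>Q2 u'\<close> by (auto simp: Q2_def form_simps mult_nonneg_nonpos)
        show "\<bar>\<omega> z (u' /\<^sub>R norm u)\<bar> \<le> 1 / norm u" if "norm z = 1" for z
          using u(2)[of z] that \<open>u' = u \<or> u' = - u\<close> \<open>u \<noteq> 0\<close>
          by (auto simp: form_simps abs_mult field_simps)
      qed
      then have "norm u \<le> 1" using \<open>u \<noteq> 0\<close> by (simp add: field_simps)
      moreover have "1 \<le> M * norm u"
        using max'[of u] u(1) antisym[of u y'] by simp
      moreover have "0 \<le> M" by (simp add: M_def)
      ultimately show ?thesis
        using mult_left_le[of "norm u" M] by linarith
    qed
    consider "Q2 u \<or> Q2 (- u)" | "0 \<le> \<omega> u w" "0 \<le> \<omega> v u" | "\<omega> u w \<le> 0" "\<omega> v u \<le> 0"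
      using quadrants[of u] by (auto simp: Q1_def form_simps)
    \<comment> \<open>In the last two cases the support line at \<open>y'\<close> is a side of the square \<open>[-1, 1]\<^sup>2\<close>.\<close>
    then show ?thesis
    proof cases
      case 1
      then show ?thesis using polar by blast
    next
      case 2
      then have "0 \<le> \<omega> v y' * \<omega> u w" using y'_coords by simp
      moreover have "\<omega> y' w * \<omega> v u \<le> \<omega> y' w"
        using u_coords y'_coords by (simp add: mult_left_le)
      ultimately show ?thesis using one y'_coords by linarith
    next
      case 3
      then have "\<omega> y' w * \<omega> v u \<le> 0" using y'_coords by (simp add: mult_nonneg_nonpos)
      moreover have "\<omega> v y' * (- \<omega> u w) \<le> \<omega> v y'"
        using u_coords y'_coords by (intro mult_left_le) auto
      ultimately show ?thesis using one y'_coords by simp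
    qed
  qed
  then show ?thesis
    using le[OF xy(1,2)] by (simp add: M_def)
qed

text \<open>A ray inside the open quadrant has to leave the bounded set \<open>K\<close> and so
  crosses its frontier. The two segments lie on the axes, so the crossing is in \<open>C\<close>,
  where every point has norm 1; hence \<open>C\<close> misses no point of the quarter
  circle.\<close>

lemma quadrant_arc_eq:
  assumes vw: "\<omega> v w = 1" and "v \<in> C" "w \<in> C"
    and C_unit: "\<And>x. x \<in> C \<Longrightarrow> norm x = 1"
    and C_quadrant: "\<And>x. x \<in> C \<Longrightarrow> 0 \<le> \<omega> x w \<and> 0 \<le> \<omega> v x"
    and K: "convex_body K" "C \<union> closed_segment 0 v \<union> closed_segment 0 w = frontier K"
  shows "C = {x. norm x = 1 \<and> 0 \<le> \<omega> x w \<and> 0 \<le> \<omega> v x}"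
proof (intro equalityI subsetI)
  fix x assume "x \<in> {x. norm x = 1 \<and> 0 \<le> \<omega> x w \<and> 0 \<le> \<omega> v x}"
  then have x: "norm x = 1" "0 \<le> \<omega> x w" "0 \<le> \<omega> v x" by auto
  have coords: "\<omega> x w *\<^sub>R v + \<omega> v x *\<^sub>R w = x"
    using coordinates[OF vw] by metis
  show "x \<in> C"
  proof (cases "\<omega> x w = 0 \<or> \<omega> v x = 0")
    case True
    then have "x = w \<or> x = v"
    proof
      assume "\<omega> x w = 0"
      then have "\<omega> v x *\<^sub>R w = x" using coords by simp
      moreover from this have "\<omega> v x = 1"
        using x C_unit[OF \<open>w \<in> C\<close>] by (metis abs_of_nonneg mult.right_neutral norm_scaleR)
      ultimately show ?thesis by simp
    next
      assume "\<omega> v x = 0"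
      then have "\<omega> x w *\<^sub>R v = x" using coords by simp
      moreover from this have "\<omega> x w = 1"
        using x C_unit[OF \<open>v \<in> C\<close>] by (metis abs_of_nonneg mult.right_neutral norm_scaleR)
      ultimately show ?thesis by simp
    qed
    then show ?thesis using assms(2,3) by auto
  next
    case False
    then have pos: "0 < \<omega> x w" "0 < \<omega> v x" using x by auto
    have "closed K" "bounded K" "convex K"
      using K(1) by (auto simp: convex_body_def compact_imp_closed compact_imp_bounded)
    then have "frontier K \<subseteq> K"
      by (simp add: frontier_def)
    then have "v \<in> K" "w \<in> K" "0 \<in> K"
      using assms(2,3) K(2) by auto
    \<comment> \<open>The point \<open>(1 / s) *\<^sub>R x\<close> is where the ray meets the chord
      from \<open>v\<close> to \<open>w\<close>. Starting there instead of at 0, which is a frontier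
      point itself, makes the crossing parameter \<open>r\<close> positive.\<close>
    define s where "s = \<omega> x w + \<omega> v x"
    have "s > 0" using pos by (simp add: s_def)
    have "(\<omega> x w / s) *\<^sub>R v + (\<omega> v x / s) *\<^sub>R w \<in> K"
      using \<open>v \<in> K\<close> \<open>w \<in> K\<close> pos \<open>s > 0\<close>
      by (intro convexD[OF \<open>convex K\<close>]) (auto simp: s_def add_divide_distrib[symmetric])
    also have "(\<omega> x w / s) *\<^sub>R v + (\<omega> v x / s) *\<^sub>R w = (1 / s) *\<^sub>R x"
      by (subst (3) coords[symmetric]) (simp add: scaleR_right_distrib)
    finally have inside: "(1 / s) *\<^sub>R x \<in> K" .
    obtain R where R: "\<And>z. z \<in> K \<Longrightarrow> norm z \<le> R"
      using \<open>bounded K\<close> bounded_iff by metis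
    define N where "N = \<bar>R\<bar> + 1 / s + 1"
    have "N > 0" "1 / s \<le> N" using \<open>s > 0\<close> by (auto simp: N_def add_nonneg_pos)
    have "norm (N *\<^sub>R x) = N"
      using x(1) \<open>N > 0\<close> by simp
    moreover have "R < N"
      using abs_ge_self[of R] divide_pos_pos[of 1 s] \<open>s > 0\<close> unfolding N_def by linarith
    ultimately have outside: "N *\<^sub>R x \<notin> K" using R by force
    have "closed_segment ((1 / s) *\<^sub>R x) (N *\<^sub>R x) \<inter> frontier K \<noteq> {}"
      using inside outside by (intro connected_Int_frontier connected_segment) auto
    then obtain t where t: "t \<in> {0..1}" "(1 - t) *\<^sub>R (1 / s) *\<^sub>R x + t *\<^sub>R N *\<^sub>R x \<in> frontier K"
      by (auto simp: closed_segment_def)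
    define r where "r = (1 - t) * (1 / s) + t * N"
    have rx: "r *\<^sub>R x \<in> frontier K"
      using t(2) by (simp add: r_def scaleR_left_distrib)
    have "r > 0"
    proof (cases "t = 0")
      case False
      then show ?thesis
        using t(1) \<open>N > 0\<close> \<open>s > 0\<close> by (simp add: r_def add_nonneg_pos)
    qed (use \<open>s > 0\<close> in \<open>simp add: r_def\<close>)
    have "\<omega> v z = 0 \<or> \<omega> z w = 0" if "z \<in> closed_segment 0 v \<union> closed_segment 0 w" for z
      using that by (auto simp: closed_segment_def form_simps)
    from this[of "r *\<^sub>R x"] have "r *\<^sub>R x \<in> C"
      using rx pos \<open>r > 0\<close> unfolding K(2)[symmetric] by (auto simp: form_simps)
    then have "r = 1"
      using C_unit[of "r *\<^sub>R x"] x(1) \<open>r > 0\<close> by simp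
    then show ?thesis using \<open>r *\<^sub>R x \<in> C\<close> by simp
  qed
qed (use C_unit C_quadrant in auto)

lemma parallelogram_subset:
  assumes "\<omega> v w = 1"
  shows "convex hull {0, v, w, v + w} \<subseteq> {x. \<omega> x w \<in> {0..1} \<and> \<omega> v x \<in> {0..1}}"
proof (rule hull_minimal)
  show "{0, v, w, v + w} \<subseteq> {x. \<omega> x w \<in> {0..1} \<and> \<omega> v x \<in> {0..1}}"
    using assms by (auto simp: form_simps)
  show "convex {x. \<omega> x w \<in> {0..1} \<and> \<omega> v x \<in> {0..1}}"
    by (rule convexI) (auto simp: form_simps intro!: convex_bound_le)
qed

lemma subset_parallelogram:
  assumes "\<omega> v w = 1"
  shows "{x. \<omega> x w \<in> {0..1} \<and> \<omega> v x \<in> {0..1}} \<subseteq> convex hull {0, v, w, v + w}"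
proof
  fix x assume x: "x \<in> {x. \<omega> x w \<in> {0..1} \<and> \<omega> v x \<in> {0..1}}"
  let ?H = "convex hull {0, v, w, v + w}"
  define a b where "a = \<omega> x w" and "b = \<omega> v x"
  have "0 \<in> ?H" "v \<in> ?H" "w \<in> ?H" "v + w \<in> ?H"
    by (auto intro: hull_inc)
  moreover have "0 \<le> a" "a \<le> 1" "0 \<le> b" "b \<le> 1"
    using x by (auto simp: a_def b_def)
  \<comment> \<open>Bilinear interpolation between the four corners.\<close>
  ultimately have "(1 - b) *\<^sub>R ((1 - a) *\<^sub>R 0 + a *\<^sub>R v) + b *\<^sub>R ((1 - a) *\<^sub>R w + a *\<^sub>R (v + w)) \<in> ?H"
    by (intro convexD_alt convex_convex_hull)
  also have "(1 - b) *\<^sub>R ((1 - a) *\<^sub>R 0 + a *\<^sub>R v) + b *\<^sub>R ((1 - a) *\<^sub>R w + a *\<^sub>R (v + w)) = a *\<^sub>R v + b *\<^sub>R w"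
    by (simp add: algebra_simps)
  also have "\<dots> = x"
    using coordinates[OF assms, of x] by (simp add: a_def b_def)
  finally show "x \<in> ?H" .
qed

text \<open>Because the dual curve lies on the unit circle, the supremum in its denominator must
  equal the norm of its numerator. This turns the construction into the polarity between the two
  quadrants.\<close>

lemma radon_curve_sphere_imp_form_eq_1:
  assumes vw: "\<omega> v w = 1" and C: "v \<in> C" "w \<in> C" "C \<subseteq> convex hull {0, v, w, v + w}"
    and K: "convex_body K" "C \<union> closed_segment 0 v \<union> closed_segment 0 w = frontier K"
    and sphere: "C \<union> dual_curve \<omega> v w C ` {0..1} \<subseteq> {x. norm x = 1}"
    and xy: "norm x = 1" "norm y = 1" "birkhoff_orthogonal x y"
  shows "\<bar>\<omega> x y\<bar> = 1"
proof -
  have C_unit: "norm z = 1" if "z \<in> C" for z using that sphere by auto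
  have C_box: "0 \<le> \<omega> z w" "\<omega> z w \<le> 1" "0 \<le> \<omega> v z" "\<omega> v z \<le> 1" if "z \<in> C" for z
    using that C(3) parallelogram_subset[OF vw] by auto
  have C_eq: "C = {x. norm x = 1 \<and> 0 \<le> \<omega> x w \<and> 0 \<le> \<omega> v x}"
    using quadrant_arc_eq[OF vw C(1,2) C_unit _ K] C_box by blast
  have polar: "(\<forall>z\<in>C. \<bar>\<omega> z y\<bar> \<le> 1) \<and> (\<forall>c. (\<forall>z\<in>C. \<bar>\<omega> z y\<bar> \<le> c) \<longrightarrow> 1 \<le> c)"
    if y: "norm y = 1" "\<omega> y w \<le> 0" "0 \<le> \<omega> v y" for y
  proof -
    define s where "s = \<omega> v y + - \<omega> y w"
    have "y = \<omega> v y *\<^sub>R w + (- \<omega> y w) *\<^sub>R (- v)"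
      using coordinates[OF vw, of y] by (simp add: add.commute)
    then obtain t where t: "t \<in> {0..1}" and yt: "(1 - t) *\<^sub>R w + t *\<^sub>R (- v) = y /\<^sub>R s" and "0 < s"
      using normalized_convex_combination[of y "\<omega> v y" w "- \<omega> y w" "- v"] y
      unfolding s_def by (metis neg_0_le_iff_le)
    define S where "S = (SUP z\<in>C. \<bar>\<omega> z (y /\<^sub>R s)\<bar>)"
    \<comment> \<open>The real supremum \<open>S\<close> is meaningful only for a bounded set; the
      bound comes from the coordinates of \<open>C\<close> lying in [0, 1].\<close>
    have bound: "\<bar>\<omega> z (y /\<^sub>R s)\<bar> \<le> \<bar>\<omega> v (y /\<^sub>R s)\<bar> + \<bar>\<omega> (y /\<^sub>R s) w\<bar>" if "z \<in> C" for z
    proof -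
      have "\<bar>\<omega> z w * \<omega> v u\<bar> \<le> \<bar>\<omega> v u\<bar>" "\<bar>\<omega> v z * \<omega> u w\<bar> \<le> \<bar>\<omega> u w\<bar>" for u
        using C_box[OF that] by (simp_all add: abs_mult mult_left_le_one_le)
      then show ?thesis
        unfolding form_coordinates[OF vw, of z "y /\<^sub>R s"]
        by (meson abs_triangle_ineq4 add_mono order_trans)
    qed
    have bdd: "bdd_above ((\<lambda>z. \<bar>\<omega> z (y /\<^sub>R s)\<bar>) ` C)"
      using bound by (intro bdd_aboveI2)
    have "dual_curve \<omega> v w C t \<in> {x. norm x = 1}"
      using sphere t by blast
    moreover have "dual_curve \<omega> v w C t = (y /\<^sub>R s) /\<^sub>R S"
      unfolding dual_curve_def Let_def yt S_def ..
    ultimately have "norm (y /\<^sub>R s) / \<bar>S\<bar> = 1"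
      by (simp only: mem_Collect_eq norm_scaleR[of "inverse S"]) (simp add: divide_inverse mult.commute)
    \<comment> \<open>The case \<open>S = 0\<close> is excluded since division by zero gives 0, not
      1.\<close>
    then have "norm (y /\<^sub>R s) = \<bar>S\<bar>"
      by (metis div_by_0 divide_eq_1_iff zero_neq_one)
    moreover have "0 \<le> S"
      unfolding S_def using C(1) by (intro cSUP_upper2[OF bdd, of v]) auto
    ultimately have "S * s = 1"
      using y(1) \<open>0 < s\<close> by (simp add: field_simps)
    have scale: "\<bar>\<omega> z (y /\<^sub>R s)\<bar> * s = \<bar>\<omega> z y\<bar>" for z
      using \<open>0 < s\<close> by (simp add: form_simps abs_mult)
    show ?thesis
    proof (intro conjI ballI allI impI)
      fix z assume "z \<in> C"
      then have "\<bar>\<omega> z (y /\<^sub>R s)\<bar> \<le> S"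
        unfolding S_def by (intro cSUP_upper bdd)
      then have "\<bar>\<omega> z (y /\<^sub>R s)\<bar> * s \<le> S * s"
        using \<open>0 < s\<close> by simp
      then show "\<bar>\<omega> z y\<bar> \<le> 1"
        using scale \<open>S * s = 1\<close> by simp
    next
      fix c assume c: "\<forall>z\<in>C. \<bar>\<omega> z y\<bar> \<le> c"
      have "S \<le> c / s"
        unfolding S_def
      proof (rule cSUP_least)
        fix z assume "z \<in> C"
        then show "\<bar>\<omega> z (y /\<^sub>R s)\<bar> \<le> c / s"
          using c scale[of z] \<open>0 < s\<close> by (simp add: pos_le_divide_eq)
      qed (use C(1) in auto)
      then show "1 \<le> c"
        using \<open>S * s = 1\<close> \<open>0 < s\<close> by (simp add: pos_le_divide_eq)
    qed
  qed
  show ?thesis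
  proof (rule form_eq_1_if_quadrants_polar[OF vw C_unit[OF C(1)] C_unit[OF C(2)]])
    show "norm z = 1 \<Longrightarrow> 0 \<le> \<omega> z w \<Longrightarrow> 0 \<le> \<omega> v z \<Longrightarrow> \<omega> z w \<le> 1 \<and> \<omega> v z \<le> 1" for z
      using C_box C_eq by blast
    show "\<bar>\<omega> z y\<bar> \<le> 1" if "norm z = 1" "0 \<le> \<omega> z w" "0 \<le> \<omega> v z"
        "norm y = 1" "\<omega> y w \<le> 0" "0 \<le> \<omega> v y" for z y
      using polar[of y] that C_eq by blast
    show "1 \<le> c" if "norm y = 1" "\<omega> y w \<le> 0" "0 \<le> \<omega> v y"
        "\<And>x. norm x = 1 \<Longrightarrow> 0 \<le> \<omega> x w \<Longrightarrow> 0 \<le> \<omega> v x \<Longrightarrow> \<bar>\<omega> x y\<bar> \<le> c" for y c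
      using polar[of y] that C_eq by blast
  qed fact+
qed

section \<open>From a constant value of the form to a Radon circle\<close>

lemma frontier_quadrant_of_ball:
  assumes vw: "\<omega> v w = 1" and unit: "norm v = 1" "norm w = 1"
  defines "K \<equiv> {x. norm x \<le> 1 \<and> 0 \<le> \<omega> x w \<and> 0 \<le> \<omega> v x}"
  shows "convex_body K"
    and "frontier K = {x. norm x = 1 \<and> 0 \<le> \<omega> x w \<and> 0 \<le> \<omega> v x}
      \<union> closed_segment 0 v \<union> closed_segment 0 w"
proof -
  interpret form: bounded_bilinear \<omega> by (rule bounded_bilinear_form) fact
  have cont: "continuous_on UNIV (\<lambda>x. \<omega> x w)" "continuous_on UNIV (\<lambda>x. \<omega> v x)"
    by (intro form.continuous_on continuous_on_id continuous_on_const)+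
  define H where "H = {x. 0 \<le> \<omega> x w} \<inter> {x. 0 \<le> \<omega> v x}"
  have K: "K = cball 0 1 \<inter> H" by (auto simp: K_def H_def)
  have "closed H"
    unfolding H_def by (intro closed_Int closed_Collect_le cont continuous_on_const)
  then have "compact K"
    unfolding K by (intro compact_Int_closed compact_unit_cball[OF vw])
  have "convex H"
    by (rule convexI) (auto simp: H_def form_simps)
  then have "convex K"
    unfolding K by (intro convex_Int convex_cball)
  define U where "U = ball 0 1 \<inter> ({x. 0 < \<omega> x w} \<inter> {x. 0 < \<omega> v x})"
  have "open U"
    unfolding U_def by (intro open_Int open_ball open_Collect_less cont continuous_on_const)
  have interior: "interior K = U"
  proof (rule interior_unique)
    show "U \<subseteq> K" by (auto simp: U_def K_def)
    show "open U" by fact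
  next
    fix T assume T: "T \<subseteq> K" "open T"
    show "T \<subseteq> U"
    proof
      fix x assume "x \<in> T"
      then obtain e where e: "0 < e" "ball x e \<subseteq> K"
        using T by (meson openE order_trans)
      have "x \<in> K" using \<open>x \<in> T\<close> T by blast
      \<comment> \<open>Small steps against \<open>v\<close>, against \<open>w\<close> and radially
        outwards stay in \<open>K\<close>; they make the three defining inequalities strict.\<close>
      have "x - (e / 2) *\<^sub>R v \<in> ball x e" "x - (e / 2) *\<^sub>R w \<in> ball x e"
        using e unit by (auto simp: dist_norm)
      then have "x - (e / 2) *\<^sub>R v \<in> K" "x - (e / 2) *\<^sub>R w \<in> K"
        using e by auto
      then have pos: "0 < \<omega> x w" "0 < \<omega> v x"
        using e vw by (auto simp: K_def form_simps)
      have "e / 2 * norm x < e"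
        using \<open>x \<in> K\<close> e mult_left_le[of "norm x" "e / 2"] unfolding K_def by simp
      then have "x + (e / 2) *\<^sub>R x \<in> ball x e"
        using e by (simp add: dist_norm)
      then have "norm (x + (e / 2) *\<^sub>R x) \<le> 1" using e by (auto simp: K_def)
      moreover have "x + (e / 2) *\<^sub>R x = (1 + e / 2) *\<^sub>R x"
        by (simp add: scaleR_left_distrib)
      ultimately have "(1 + e / 2) * norm x \<le> 1"
        using e by simp
      moreover have "0 < norm x" using pos by (auto simp: form_simps)
      then have "norm x < (1 + e / 2) * norm x" using e by simp
      ultimately show "x \<in> U" using pos by (simp add: U_def)
    qed
  qed
  have "(1 / 4) *\<^sub>R v + (1 / 4) *\<^sub>R w \<in> U"
    using vw unit norm_triangle_ineq[of "(1 / 4) *\<^sub>R v" "(1 / 4) *\<^sub>R w"]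
    by (simp add: U_def form_simps)
  then show "convex_body K"
    using \<open>compact K\<close> \<open>convex K\<close> interior by (auto simp: convex_body_def)
  have frontier: "frontier K = K - U"
    using \<open>compact K\<close> interior by (simp add: frontier_def compact_imp_closed)
  show "frontier K = {x. norm x = 1 \<and> 0 \<le> \<omega> x w \<and> 0 \<le> \<omega> v x}
      \<union> closed_segment 0 v \<union> closed_segment 0 w"
    unfolding frontier
  proof (intro equalityI subsetI)
    fix x assume x: "x \<in> K - U"
    have coords: "\<omega> x w *\<^sub>R v + \<omega> v x *\<^sub>R w = x"
      using coordinates[OF vw] by metis
    consider "norm x = 1" | "\<omega> v x = 0" | "\<omega> x w = 0"
      using x by (force simp: K_def U_def)
    then show "x \<in> {x. norm x = 1 \<and> 0 \<le> \<omega> x w \<and> 0 \<le> \<omega> v x}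
      \<union> closed_segment 0 v \<union> closed_segment 0 w"
    proof cases
      case 1
      then show ?thesis using x by (simp add: K_def)
    next
      case 2
      then have "x = \<omega> x w *\<^sub>R v" using coords by simp
      moreover from this have "norm x = \<bar>\<omega> x w\<bar>" using unit by (metis mult.right_neutral norm_scaleR)
      ultimately have "x \<in> closed_segment 0 v"
        using x unfolding closed_segment_def K_def by force
      then show ?thesis by simp
    next
      case 3
      then have "x = \<omega> v x *\<^sub>R w" using coords by simp
      moreover from this have "norm x = \<bar>\<omega> v x\<bar>" using unit by (metis mult.right_neutral norm_scaleR)
      ultimately have "x \<in> closed_segment 0 w"
        using x unfolding closed_segment_def K_def by force
      then show ?thesis by simp
    qed
  next
    fix x assume "x \<in> {x. norm x = 1 \<and> 0 \<le> \<omega> x w \<and> 0 \<le> \<omega> v x}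
      \<union> closed_segment 0 v \<union> closed_segment 0 w"
    then show "x \<in> K - U"
      using vw unit by (auto simp: K_def U_def closed_segment_def form_simps)
  qed
qed

lemma arc_quadrant_of_sphere:
  assumes vw: "\<omega> v w = 1" and unit: "norm v = 1" "norm w = 1"
  defines "g \<equiv> \<lambda>t. ((1 - t) *\<^sub>R v + t *\<^sub>R w) /\<^sub>R norm ((1 - t) *\<^sub>R v + t *\<^sub>R w)"
  shows "arc g" "pathstart g = v" "pathfinish g = w"
    and "path_image g = {x. norm x = 1 \<and> 0 \<le> \<omega> x w \<and> 0 \<le> \<omega> v x}"
proof -
  define p where "p t = (1 - t) *\<^sub>R v + t *\<^sub>R w" for t
  have g: "g t = p t /\<^sub>R norm (p t)" for t by (simp add: g_def p_def)
  have p_coords: "\<omega> (p t) w = 1 - t" "\<omega> v (p t) = t" for t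
    using vw by (simp_all add: p_def form_simps)
  have p_nonzero: "p t \<noteq> 0" for t
  proof
    assume "p t = 0"
    with p_coords[of t] show False by (simp add: form_simps)
  qed
  have "continuous_on {0..1} g"
    unfolding g_def using p_nonzero by (intro continuous_intros) (simp add: p_def)
  moreover have "inj_on g {0..1}"
  proof (rule inj_onI)
    \<comment> \<open>The form separates the points of the chord:
      \<open>\<omega> (p s) (p t)\<close> equals \<open>t - s\<close>.\<close>
    fix s t assume "g s = g t"
    then have "\<omega> (g s) (g t) = 0" by simp
    then have "\<omega> (p s) (p t) = 0"
      using p_nonzero by (simp add: g form_simps)
    then show "s = t"
      using form_coordinates[OF vw, of "p s" "p t"] by (simp add: p_coords algebra_simps)
  qed
  ultimately show "arc g" by (simp add: arc_def path_def)
  show "pathstart g = v" "pathfinish g = w"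
    using unit by (simp_all add: pathstart_def pathfinish_def g_def)
  show "path_image g = {x. norm x = 1 \<and> 0 \<le> \<omega> x w \<and> 0 \<le> \<omega> v x}"
  proof (intro equalityI subsetI)
    fix x assume "x \<in> {x. norm x = 1 \<and> 0 \<le> \<omega> x w \<and> 0 \<le> \<omega> v x}"
    then have x: "norm x = 1" "0 \<le> \<omega> x w" "0 \<le> \<omega> v x" by auto
    obtain t where "t \<in> {0..1}" "x = g t"
      unfolding g_def using normalized_convex_combination[OF x(1) coordinates[OF vw, of x] x(2,3)]
      by blast
    then show "x \<in> path_image g" by (auto simp: path_image_def)
  next
    fix x assume "x \<in> path_image g"
    then show "x \<in> {x. norm x = 1 \<and> 0 \<le> \<omega> x w \<and> 0 \<le> \<omega> v x}"
      using p_nonzero by (auto simp: path_image_def g form_simps p_coords)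
  qed
qed

text \<open>Over the whole circle the supremum is \<open>norm y\<close> and is attained. A maximiser
  outside \<open>C\<close> and \<open>- C\<close> has coordinates of opposite signs, so the terms of
  \<open>\<omega> x w * (1 - l) + \<omega> v x * l\<close> partly cancel and leave at most
  \<open>max (1 - l) l\<close>, a value which \<open>v\<close> or \<open>w\<close> already
  reaches.\<close>

lemma form_sup_quadrant:
  assumes vw: "\<omega> v w = 1" and unit: "norm v = 1" "norm w = 1"
    and bound: "\<And>x y. \<bar>\<omega> x y\<bar> \<le> norm x * norm y"
    and attained: "\<And>y. norm y = 1 \<Longrightarrow> \<exists>x. norm x = 1 \<and> \<bar>\<omega> x y\<bar> = 1"
    and l: "l \<in> {0..1}"
  defines "C \<equiv> {x. norm x = 1 \<and> 0 \<le> \<omega> x w \<and> 0 \<le> \<omega> v x}"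
    and "y \<equiv> (1 - l) *\<^sub>R w + l *\<^sub>R (- v)"
  shows "(SUP x\<in>C. \<bar>\<omega> x y\<bar>) = norm y"
proof (rule cSup_eq_maximum)
  show "z \<le> norm y" if z: "z \<in> (\<lambda>x. \<bar>\<omega> x y\<bar>) ` C" for z
  proof -
    obtain x where "norm x = 1" "z = \<bar>\<omega> x y\<bar>"
      using z by (auto simp: C_def)
    then show ?thesis using bound[of x y] by simp
  qed
  have "v \<in> C" "w \<in> C"
    using vw unit by (auto simp: C_def)
  have at_vw: "\<omega> v y = 1 - l" "\<omega> w y = l"
    using vw antisym[of w v] by (simp_all add: y_def form_simps)
  have y_coords: "\<omega> y w = - l"
    using at_vw antisym[of y w] by simp
  have "y \<noteq> 0"
    using at_vw l by (auto simp: form_simps)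
  then obtain x where x: "norm x = 1" "\<bar>\<omega> x (y /\<^sub>R norm y)\<bar> = 1"
    using attained[of "y /\<^sub>R norm y"] by auto
  then have xy: "\<bar>\<omega> x y\<bar> = norm y"
    using \<open>y \<noteq> 0\<close> by (simp add: form_simps abs_mult field_simps)
  have corner: "\<exists>z\<in>C. norm y \<le> \<bar>\<omega> z y\<bar>" if "norm y \<le> max (1 - l) l"
  proof (cases "l \<le> 1 - l")
    case True
    then show ?thesis using that \<open>v \<in> C\<close> at_vw by (intro bexI[of _ v]) auto
  next
    case False
    then show ?thesis using that \<open>w \<in> C\<close> at_vw by (intro bexI[of _ w]) auto
  qed
  consider "x \<in> C" | "- x \<in> C" | "0 \<le> \<omega> x w" "\<omega> v x \<le> 0" | "\<omega> x w \<le> 0" "0 \<le> \<omega> v x"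
    using x(1) linear[of 0 "\<omega> x w"] linear[of 0 "\<omega> v x"] by (auto simp: C_def form_simps)
  then have "\<exists>z\<in>C. norm y \<le> \<bar>\<omega> z y\<bar>"
  proof cases
    case 1
    then show ?thesis using xy by (intro bexI[of _ x]) auto
  next
    case 2
    then show ?thesis using xy by (intro bexI[of _ "- x"]) (auto simp: form_simps)
  next
    case 3
    have "\<bar>\<omega> x w\<bar> \<le> 1" "\<bar>\<omega> v x\<bar> \<le> 1"
      using bound[of x w] bound[of v x] x(1) unit by simp_all
    with 3 l have "0 \<le> \<omega> x w * (1 - l)" "\<omega> x w * (1 - l) \<le> 1 - l" "\<omega> v x * l \<le> 0" "- \<omega> v x * l \<le> l"
      using mult_left_le_one_le[of "1 - l" "\<omega> x w"] mult_left_le_one_le[of l "- \<omega> v x"]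
      by (auto simp: mult_nonpos_nonneg)
    then have "norm y \<le> max (1 - l) l"
      using xy form_coordinates[OF vw, of x y] at_vw y_coords by (simp add: abs_if max_def split: if_splits)
    then show ?thesis by (rule corner)
  next
    case 4
    have "\<bar>\<omega> x w\<bar> \<le> 1" "\<bar>\<omega> v x\<bar> \<le> 1"
      using bound[of x w] bound[of v x] x(1) unit by simp_all
    with 4 l have "\<omega> x w * (1 - l) \<le> 0" "- \<omega> x w * (1 - l) \<le> 1 - l" "0 \<le> \<omega> v x * l" "\<omega> v x * l \<le> l"
      using mult_left_le_one_le[of "1 - l" "- \<omega> x w"] mult_left_le_one_le[of l "\<omega> v x"]
      by (auto simp: mult_nonpos_nonneg)
    then have "norm y \<le> max (1 - l) l"
      using xy form_coordinates[OF vw, of x y] at_vw y_coords by (simp add: abs_if max_def split: if_splits)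
    then show ?thesis by (rule corner)
  qed
  then obtain z where "z \<in> C" "norm y \<le> \<bar>\<omega> z y\<bar>" by blast
  moreover have "\<bar>\<omega> z y\<bar> \<le> norm y"
    using bound[of z y] \<open>z \<in> C\<close> by (simp add: C_def)
  ultimately show "norm y \<in> (\<lambda>x. \<bar>\<omega> x y\<bar>) ` C"
    by (intro image_eqI[of _ _ z]) auto
qed

text \<open>Together \<open>bound\<close> and \<open>attained\<close> say that the norm agrees with
  its polar norm. The denominator of the dual curve is then the norm of the numerator, so this curve
  is the arc of the circle in the second quadrant, and central symmetry supplies the rest.\<close>

lemma radon_curve_sphere:
  assumes vw: "\<omega> v w = 1" and unit: "norm v = 1" "norm w = 1"
    and bound: "\<And>x y. \<bar>\<omega> x y\<bar> \<le> norm x * norm y"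
    and attained: "\<And>y. norm y = 1 \<Longrightarrow> \<exists>x. norm x = 1 \<and> \<bar>\<omega> x y\<bar> = 1"
  shows "radon_curve {x::'a. norm x = 1}"
proof -
  define C where "C = {x. norm x = 1 \<and> 0 \<le> \<omega> x w \<and> 0 \<le> \<omega> v x}"
  define g where "g t = ((1 - t) *\<^sub>R v + t *\<^sub>R w) /\<^sub>R norm ((1 - t) *\<^sub>R v + t *\<^sub>R w)" for t
  define K where "K = {x. norm x \<le> 1 \<and> 0 \<le> \<omega> x w \<and> 0 \<le> \<omega> v x}"
  have "v \<noteq> w" using vw by auto
  have "independent {v, w}"
  proof (rule independent_insertI)
    show "v \<notin> span {w}"
      using vw by (auto simp: span_singleton form_simps)
    have "w \<noteq> 0" using unit by auto
    then show "independent {w}" by simp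
  qed
  have arc: "arc g" "pathstart g = v" "pathfinish g = w" "C = path_image g"
    using arc_quadrant_of_sphere[OF vw unit] unfolding g_def C_def by auto
  have "C \<subseteq> convex hull {0, v, w, v + w}"
  proof (rule subset_trans[OF _ subset_parallelogram[OF vw]], rule subsetI)
    fix x assume "x \<in> C"
    then show "x \<in> {x. \<omega> x w \<in> {0..1} \<and> \<omega> v x \<in> {0..1}}"
      using bound[of x w] bound[of v x] unit by (auto simp: C_def)
  qed
  have K: "convex_body K" "C \<union> closed_segment 0 v \<union> closed_segment 0 w = frontier K"
    using frontier_quadrant_of_ball[OF vw unit] by (auto simp: K_def C_def)
  have dual: "dual_curve \<omega> v w C l =
      ((1 - l) *\<^sub>R w + l *\<^sub>R (- v)) /\<^sub>R norm ((1 - l) *\<^sub>R w + l *\<^sub>R (- v))" if "l \<in> {0..1}" for l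
    unfolding dual_curve_def Let_def C_def
    using form_sup_quadrant[OF vw unit bound attained that] by simp
  have D: "dual_curve \<omega> v w C ` {0..1} = {x. norm x = 1 \<and> \<omega> x w \<le> 0 \<and> 0 \<le> \<omega> v x}" (is "?D = _")
  proof (intro equalityI subsetI)
    fix x assume "x \<in> {x. norm x = 1 \<and> \<omega> x w \<le> 0 \<and> 0 \<le> \<omega> v x}"
    then have x: "norm x = 1" "0 \<le> - \<omega> x w" "0 \<le> \<omega> v x" by auto
    have "x = \<omega> v x *\<^sub>R w + (- \<omega> x w) *\<^sub>R (- v)"
      using coordinates[OF vw, of x] by (simp add: add.commute)
    then obtain l where "l \<in> {0..1}"
        "x = ((1 - l) *\<^sub>R w + l *\<^sub>R (- v)) /\<^sub>R norm ((1 - l) *\<^sub>R w + l *\<^sub>R (- v))"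
      using normalized_convex_combination[OF x(1) _ x(3,2)] by blast
    then have "x = dual_curve \<omega> v w C l" using dual by simp
    then show "x \<in> ?D" using \<open>l \<in> {0..1}\<close> by (rule image_eqI)
  next
    fix x assume "x \<in> ?D"
    then obtain l where l: "l \<in> {0..1}" and x: "x = dual_curve \<omega> v w C l" by blast
    define y where "y = (1 - l) *\<^sub>R w + l *\<^sub>R (- v)"
    have y: "\<omega> y w = - l" "\<omega> v y = 1 - l"
      using vw by (simp_all add: y_def form_simps)
    have "y \<noteq> 0"
    proof
      assume "y = 0"
      with y show False by (simp add: form_simps)
    qed
    moreover have "x = y /\<^sub>R norm y"
      using dual[OF l] x by (simp add: y_def)
    ultimately show "x \<in> {x. norm x = 1 \<and> \<omega> x w \<le> 0 \<and> 0 \<le> \<omega> v x}"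
      using y l by (simp add: form_simps mult_nonneg_nonpos)
  qed
  have sphere: "{x. norm x = 1} = C \<union> ?D \<union> uminus ` C \<union> uminus ` ?D"
  proof (intro equalityI subsetI)
    fix x :: 'a assume "x \<in> {x. norm x = 1}"
    then have "x \<in> C \<or> x \<in> ?D \<or> - x \<in> C \<or> - x \<in> ?D"
      unfolding C_def[symmetric] D by (auto simp: C_def form_simps)
    then show "x \<in> C \<union> ?D \<union> uminus ` C \<union> uminus ` ?D"
      by (metis UnCI image_eqI minus_minus)
  next
    fix x assume "x \<in> C \<union> ?D \<union> uminus ` C \<union> uminus ` ?D"
    then show "x \<in> {x. norm x = 1}"
      unfolding D by (auto simp: C_def)
  qed
  show ?thesis
    unfolding radon_curve_def
  proof (intro exI conjI)
    show "C = path_image g" by fact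
    show "?D = ?D" ..
    show "{x. norm x = 1} = C \<union> ?D \<union> uminus ` C \<union> uminus ` ?D" by (fact sphere)
    show "convex_body K" "C \<union> closed_segment 0 v \<union> closed_segment 0 w = frontier K" by (fact K)+
  qed (fact symplectic vw \<open>v \<noteq> w\<close> \<open>independent {v, w}\<close> arc \<open>C \<subseteq> _\<close>)+
qed

end

section \<open>The equivalence for an arbitrary symplectic form\<close>

theorem proposition4p1:
  fixes \<omega> :: "'a::real_normed_vector \<Rightarrow> 'a \<Rightarrow> real"
  assumes "dim (UNIV :: 'a set) = 2"
    and "symplectic_form \<omega>"
  shows "radon_plane TYPE('a) \<longleftrightarrow>
    (\<exists>l::real. l > 0 \<and>
      (\<forall>x y. norm x = 1 \<and> norm y = 1 \<and> birkhoff_orthogonal x y \<longrightarrow> \<bar>\<omega> x y\<bar> = l))"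
proof
  interpret symplectic_plane \<omega>
    by (rule symplectic_plane_if_dim_2) fact+
  assume "radon_plane TYPE('a)"
  then obtain v w :: 'a and \<omega>' g K where
    \<omega>': "symplectic_form \<omega>'" "\<omega>' v w = 1" and
    g: "pathstart g = v" "pathfinish g = w" "path_image g \<subseteq> convex hull {0, v, w, v + w}" and
    K: "convex_body K" "path_image g \<union> closed_segment 0 v \<union> closed_segment 0 w = frontier K" and
    sphere: "{x::'a. norm x = 1} = path_image g \<union> dual_curve \<omega>' v w (path_image g) ` {0..1}
      \<union> uminus ` path_image g \<union> uminus ` dual_curve \<omega>' v w (path_image g) ` {0..1}"
    unfolding radon_plane_def radon_curve_def by metis
  interpret \<omega>': symplectic_plane \<omega>'
    by (rule symplectic_plane_if_dim_2) fact+
  \<comment> \<open>Symplectic forms of the plane are unique up to a factor; this is where the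
    constant \<open>\<bar>\<omega> v w\<bar>\<close> comes from.\<close>
  have proportional: "\<omega> x y = \<omega> v w * \<omega>' x y" for x y
  proof -
    have "\<omega> x y = \<omega> (\<omega>' x w *\<^sub>R v + \<omega>' v x *\<^sub>R w) (\<omega>' y w *\<^sub>R v + \<omega>' v y *\<^sub>R w)"
      by (simp flip: \<omega>'.coordinates[OF \<omega>'(2)])
    also have "\<dots> = \<omega> v w * (\<omega>' x w * \<omega>' v y - \<omega>' v x * \<omega>' y w)"
      by (simp add: form_simps antisym[of w v] algebra_simps)
    finally show ?thesis
      using \<omega>'.form_coordinates[OF \<omega>'(2), of x y] by simp
  qed
  have "v \<in> path_image g" "w \<in> path_image g"
    using g pathstart_in_path_image pathfinish_in_path_image by blast+
  then have one: "\<bar>\<omega>' x y\<bar> = 1"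
    if "norm x = 1" "norm y = 1" "birkhoff_orthogonal x y" for x y
    using \<omega>'.radon_curve_sphere_imp_form_eq_1[OF \<omega>'(2) _ _ g(3) K _ that] sphere by blast
  have "v \<noteq> 0" using \<omega>'(2) by (auto simp: \<omega>'.form_simps)
  then obtain x where "\<omega> x v \<noteq> 0" using nondegenerate by blast
  then have "\<omega> v w \<noteq> 0" using proportional[of x v] by auto
  then show "\<exists>l::real. l > 0 \<and>
      (\<forall>x y. norm x = 1 \<and> norm y = 1 \<and> birkhoff_orthogonal x y \<longrightarrow> \<bar>\<omega> x y\<bar> = l)"
    using one by (intro exI[of _ "\<bar>\<omega> v w\<bar>"]) (metis proportional abs_mult mult.right_neutral zero_less_abs_iff)
next
  interpret symplectic_plane \<omega>
    by (rule symplectic_plane_if_dim_2) fact+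
  assume "\<exists>l::real. l > 0 \<and>
      (\<forall>x y. norm x = 1 \<and> norm y = 1 \<and> birkhoff_orthogonal x y \<longrightarrow> \<bar>\<omega> x y\<bar> = l)"
  then obtain l where l: "l > 0"
    "\<And>x y. norm x = 1 \<Longrightarrow> norm y = 1 \<Longrightarrow> birkhoff_orthogonal x y \<Longrightarrow> \<bar>\<omega> x y\<bar> = l"
    by blast
  have "\<exists>b::'a. b \<noteq> 0"
  proof (rule ccontr)
    assume "\<not> ?thesis"
    then have "(UNIV :: 'a set) = {0}" by auto
    then show False using assms(1) dim_unique[of "{}" "{0 :: 'a}" 0] independent_empty by simp
  qed
  then obtain b :: 'a where "b \<noteq> 0" by blast
  then obtain a where "\<omega> a b \<noteq> 0" using nondegenerate by blast
  \<comment> \<open>Existence of orthogonal vectors relies on coordinates, so some pair with form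
    value 1 is needed before \<open>v\<close> and \<open>w\<close> are available.\<close>
  then have "\<omega> (a /\<^sub>R \<omega> a b) b = 1" by (simp add: form_simps)
  note birkhoff = birkhoff_orthogonal_exists[OF this]
  \<comment> \<open>An orthogonal \<open>x\<close> always exists, so for every unit \<open>y\<close>
    the functional \<open>\<omega> _ y\<close> has norm exactly \<open>l\<close>.\<close>
  have max: "\<exists>x. norm x = 1 \<and> \<bar>\<omega> x y\<bar> = l \<and> (\<forall>z. \<bar>\<omega> z y\<bar> \<le> l * norm z)" if "norm y = 1" for y
  proof -
    have "y \<noteq> 0" using that by auto
    then obtain x where x: "norm x = 1" "birkhoff_orthogonal x y" using birkhoff by blast
    then have "\<bar>\<omega> x y\<bar> = l" using l that by blast
    then show ?thesis
      using birkhoff_orthogonal_imp_maximal[OF x] x(1) by auto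
  qed
  have bound: "\<bar>\<omega> z y\<bar> \<le> l * norm z * norm y" for z y
  proof (cases "y = 0")
    case False
    then have "\<bar>\<omega> z (y /\<^sub>R norm y)\<bar> \<le> l * norm z"
      using max[of "y /\<^sub>R norm y"] by auto
    then show ?thesis using False by (simp add: form_simps abs_mult field_simps)
  qed (simp add: form_simps)
  \<comment> \<open>Any unit vector can serve as \<open>w\<close>; as \<open>v\<close> a maximiser
    of the functional \<open>\<omega> _ w\<close> is taken. Dividing the form by
    \<open>\<omega> v w\<close>, of modulus \<open>l\<close>, then normalises the basis and the
    bound at once.\<close>
  define w where "w = b /\<^sub>R norm b"
  have "norm w = 1" using \<open>b \<noteq> 0\<close> by (simp add: w_def)
  then obtain v where v: "norm v = 1" "\<bar>\<omega> v w\<bar> = l" using max by blast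
  define \<omega>' where "\<omega>' x y = \<omega> x y / \<omega> v w" for x y
  have "\<omega> v w \<noteq> 0" using v l by auto
  have "bilinear \<omega>'"
    unfolding bilinear_def \<omega>'_def
    by (auto intro!: linearI simp: form_simps add_divide_distrib)
  then have "symplectic_form \<omega>'"
    using symplectic \<open>\<omega> v w \<noteq> 0\<close> by (simp add: symplectic_form_def \<omega>'_def)
  then interpret \<omega>': symplectic_plane \<omega>'
    by (intro symplectic_plane_if_dim_2 assms(1))
  show "radon_plane TYPE('a)"
    unfolding radon_plane_def
  proof (rule \<omega>'.radon_curve_sphere)
    show "\<omega>' v w = 1" "norm v = 1" "norm w = 1"
      using \<open>\<omega> v w \<noteq> 0\<close> v(1) \<open>norm w = 1\<close> by (auto simp: \<omega>'_def)
    show "\<bar>\<omega>' x y\<bar> \<le> norm x * norm y" for x y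
      using bound[of x y] v(2) l(1) by (simp add: \<omega>'_def field_simps)
    show "\<exists>x. norm x = 1 \<and> \<bar>\<omega>' x y\<bar> = 1" if "norm y = 1" for y
      using max[OF that] v(2) l(1) by (auto simp: \<omega>'_def)
  qed
qed

end
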